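(* The family $\mathcal{G}^{\mathrm{cs}}$ is closed under suppression; that is, if $G^*\in\mathcal{G}^{\mathrm{cs}}$ and $G$ is obtained from $G^*$ by suppression of a vertex $v$ of degree two which is not on a triangle of $G^*$, then $G\in\mathcal{G}^{\mathrm{cs}}$.
   Context: All graphs are finite, simple, undirected and connected (except that induced subgraphs considered below may be disconnected). For a graph $G$ and $S\subset V(G)$, $G[S]$ is the subgraph induced by $S$ and $G-S=G[V(G)\setminus S]$. "Component" means connected component (often identified with its vertex set). A weight function $w$ on $V(G)$ is a map assigning a positive real number to each vertex; $\mathcal{W}(G)$ is the set of all weight functions on $V(G)$. For $X\subset V(G)$, $w(X)=\sum_{v\in X}w(v)$. For disjoint $A,B\subset V(G)$, $E(A,B)$ is the set of edges joining a vertex of $A$ to a vertex of $B$. A non-empty subset $S\subset V(G)$ is a weighted safe set of $(G,w)$ if for every component $C$ of $G[S]$ and every component $D$ of $G-S$, $w(C)\ge w(D)$ whenever $E(C,D)\neq\emptyset$. If moreover $G[S]$ is connected, $S$ is a connected weighted safe set. The weighted safe number is $\mathrm{s}(G,w)=\min\{w(S)\mid S$ is a weighted safe set of $(G,w)\}$, and the connected weighted safe number is $\mathrm{cs}(G,w)=\min\{w(S)\mid S$ is a connected weighted safe set of $(G,w)\}$. $\mathcal{G}^{\mathrm{cs}}$ is the family of all (connected) graphs $G$ such that $\mathrm{s}(G,w)=\mathrm{cs}(G,w)$ for every $w\in\mathcal{W}(G)$. For a vertex $v$ of degree two in a graph which is not on a triangle, suppression of $v$ is the operation of removing $v$ and adding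 an edge between the two neighbors of $v$. *)

theory Defs
  imports Complex_Main "Graph_Theory.Digraph_Component"
begin

text \<open>
  Finite simple undirected graphs are \<^locale>\<open>pair_graph\<close>s: an edge between \<open>a\<close> and \<open>b\<close> is the
  pair of opposite arcs \<open>(a, b)\<close>, \<open>(b, a)\<close>. Consequently \<^const>\<open>out_degree\<close> is the degree.
  The qualifier in \<open>Digraph_Component.connected\<close> keeps it apart from topological connectedness;
  that predicate excludes the null graph.
\<close>

definition components :: "('a, 'b) pre_digraph \<Rightarrow> 'a set set" where
  "components H = verts ` {C. pre_digraph.max_subgraph H Digraph_Component.connected C}"

definition edges_between :: "'a pair_pre_digraph \<Rightarrow> 'a set \<Rightarrow> 'a set \<Rightarrow> ('a \<times> 'a) set" where
  "edges_between G A B = {(a, b) \<in> parcs G. a \<in> A \<and> b \<in> B}"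

text \<open>Weight functions are total in HOL; only the values on the vertices of the graph matter.\<close>

definition weight_functions :: "'a pair_pre_digraph \<Rightarrow> ('a \<Rightarrow> real) set" where
  "weight_functions G = {w. \<forall>v \<in> pverts G. 0 < w v}"

definition weighted_safe_set :: "'a pair_pre_digraph \<Rightarrow> ('a \<Rightarrow> real) \<Rightarrow> 'a set \<Rightarrow> bool" where
  "weighted_safe_set G w S \<longleftrightarrow>
     S \<noteq> {} \<and> S \<subseteq> pverts G \<and>
     (\<forall>C \<in> components (with_proj G \<restriction> S).
      \<forall>D \<in> components (with_proj G \<restriction> (pverts G - S)).
        edges_between G C D \<noteq> {} \<longrightarrow> sum w C \<ge> sum w D)"

definition connected_weighted_safe_set :: "'a pair_pre_digraph \<Rightarrow> ('a \<Rightarrow> real) \<Rightarrow> 'a set \<Rightarrow> bool" where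
  "connected_weighted_safe_set G w S \<longleftrightarrow>
     weighted_safe_set G w S \<and> Digraph_Component.connected (with_proj G \<restriction> S)"

text \<open>
  Both minima below range over finite sets, which are non-empty for connected \<open>G\<close>, since
  \<open>pverts G\<close> is then a connected weighted safe set.
\<close>

definition safe_number :: "'a pair_pre_digraph \<Rightarrow> ('a \<Rightarrow> real) \<Rightarrow> real" where
  "safe_number G w = Min {sum w S | S. weighted_safe_set G w S}"

definition connected_safe_number :: "'a pair_pre_digraph \<Rightarrow> ('a \<Rightarrow> real) \<Rightarrow> real" where
  "connected_safe_number G w = Min {sum w S | S. connected_weighted_safe_set G w S}"

definition Gcs :: "'a pair_pre_digraph set" where
  "Gcs = {G. pair_graph G \<and> Digraph_Component.connected (with_proj G) \<and>
             (\<forall>w \<in> weight_functions G. safe_number G w = connected_safe_number G w)}"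

definition on_triangle :: "'a pair_pre_digraph \<Rightarrow> 'a \<Rightarrow> bool" where
  "on_triangle G v \<longleftrightarrow> (\<exists>a b. (v, a) \<in> parcs G \<and> (a, b) \<in> parcs G \<and> (b, v) \<in> parcs G)"

text \<open>
  If \<open>v\<close> has exactly the two neighbours \<open>a\<close> and \<open>b\<close>, the arcs added are \<open>(a, b)\<close> and \<open>(b, a)\<close>.
\<close>

definition suppress :: "'a pair_pre_digraph \<Rightarrow> 'a \<Rightarrow> 'a pair_pre_digraph" where
  "suppress G v =
     \<lparr> pverts = pverts G - {v},
       parcs = {e \<in> parcs G. fst e \<noteq> v \<and> snd e \<noteq> v} \<union>
               {(a, b). (v, a) \<in> parcs G \<and> (v, b) \<in> parcs G \<and> a \<noteq> b} \<rparr>"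

end

theory Submission
  imports Defs
begin

text \<open>
  Let \<open>H\<close> be the original graph, \<open>v\<close> the suppressed vertex with neighbours \<open>a\<close> and \<open>b\<close>, and \<open>G\<close> the
  result. Suppose that some weight \<open>w\<close> on \<open>G\<close> has \<open>s(G,w) < cs(G,w)\<close>, and let \<open>S\<close> be a safe set of
  \<open>G\<close> of minimum weight. The idea is to transport this gap to \<open>H\<close> by a weight \<open>w'\<close> that exceeds \<open>w\<close>
  by a tiny \<open>\<delta>\<close> on each vertex of \<open>S\<close> and gives \<open>v\<close> the weight \<open>\<delta>\<close>.

  Giving \<open>v\<close> a small weight alone would not do: if \<open>a\<close> and \<open>b\<close> lie outside \<open>S\<close>, then \<open>v\<close> must be
  left outside as well, because alone it would be too light a component of the safe set; but its
  weight may spoil a tie \<open>w(C) = w(D)\<close> between a component \<open>C\<close> of \<open>G[S]\<close> and the component \<open>D\<close> of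
  \<open>G - S\<close> that contains \<open>a\<close> and \<open>b\<close>. The extra \<open>\<delta>\<close> on \<open>S\<close> pays for this, because \<open>C\<close> contains at
  least one vertex. If \<open>a\<close> or \<open>b\<close> is in \<open>S\<close>, then \<open>v\<close> joins \<open>S\<close>, which creates no new component
  and no new comparison. So \<open>S\<close> extends to a safe set of \<open>(H,w')\<close> of almost the same weight
  (lemma \<open>lift_safe\<close>).

  Conversely, deleting \<open>v\<close> from a connected safe set of \<open>(H,w')\<close> leaves a connected safe set of
  \<open>(G,w)\<close> (lemma \<open>project_connected_safe\<close>): the set \<open>{v}\<close> is too light to be safe, and otherwise, up to \<open>v\<close>, the components are the same in \<open>H\<close> and in
  \<open>G\<close>. As \<open>w\<close> takes finitely many values on vertex sets, a strict inequality between two of them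
  survives a small perturbation (lemma \<open>subset_sums_separated\<close>), so a violated condition
  in \<open>(G,w)\<close> would be violated in \<open>(H,w')\<close>. Hence \<open>s(H,w') < cs(H,w')\<close>, contradicting that \<open>H\<close> is
  in the family.
\<close>

section \<open>Components and safe sets in terms of reachability\<close>

definition component_at :: "'a pair_pre_digraph \<Rightarrow> 'a set \<Rightarrow> 'a \<Rightarrow> 'a set" where
  "component_at G X x = {y. (x, y) \<in> rtrancl_on X (parcs G)}"

lemma component_at_subset: "component_at G X x \<subseteq> X"
  by (auto simp: component_at_def dest: in_rtrancl_on_in_F)

lemma component_at_self: "x \<in> X \<Longrightarrow> x \<in> component_at G X x"
  by (auto simp: component_at_def)

lemma component_at_eq:
  assumes "sym (parcs G)" "y \<in> component_at G X x"
  shows "component_at G X y = component_at G X x"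
proof -
  have "sym (rtrancl_on X (parcs G))"
    using assms(1) by (rule rtrancl_on_sym)
  then show ?thesis
    using assms(2) unfolding component_at_def
    by (auto dest: symD intro: rtrancl_on_trans)
qed

lemma arcs_ends_induce:
  "arcs_ends (with_proj G \<restriction> X) = parcs G \<inter> X \<times> X"
  by (force simp: arcs_ends_conv)

lemma rtrancl_on_restrict: "rtrancl_on X (r \<inter> X \<times> X) = rtrancl_on X r"
proof (intro set_eqI iffI; clarify)
  fix x y assume "(x, y) \<in> rtrancl_on X r"
  then show "(x, y) \<in> rtrancl_on X (r \<inter> X \<times> X)"
    by (induction rule: rtrancl_on_induct) (auto intro: rtrancl_on_into_rtrancl_on)
next
  fix x y assume "(x, y) \<in> rtrancl_on X (r \<inter> X \<times> X)"
  then show "(x, y) \<in> rtrancl_on X r"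
    by (induction rule: rtrancl_on_induct) (auto intro: rtrancl_on_into_rtrancl_on)
qed

lemma reachable_induce_iff:
  "x \<rightarrow>\<^sup>*\<^bsub>with_proj G \<restriction> X\<^esub> y \<longleftrightarrow> y \<in> component_at G X x"
  by (simp add: reachable_def component_at_def arcs_ends_induce rtrancl_on_restrict)

lemma arc_mono_connected: "arc_mono Digraph_Component.connected"
  unfolding arc_mono_def
  by (metis spanning_def subgraphE wf_digraph.connected_spanning_imp_connected)

lemma (in wf_digraph) strongly_connected_imp_connected:
  "strongly_connected G \<Longrightarrow> Digraph_Component.connected G"
  unfolding Digraph_Component.connected_def strongly_connected_def
  using reachable_mk_symmetricI by auto

text \<open>
  In a symmetric digraph a maximal connected subgraph is induced, hence symmetric itself, so that
  connectedness and strong connectedness select the same subgraphs. Components are thus strongly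
  connected components, that is, classes of mutual reachability.
\<close>

lemma (in sym_digraph) max_connected_iff_max_strongly_connected:
  "max_subgraph Digraph_Component.connected C \<longleftrightarrow> max_subgraph strongly_connected C"
proof
  assume C: "max_subgraph Digraph_Component.connected C"
  then have ind: "induced_subgraph C G"
    using arc_mono_connected by (rule induced_subgraphI_arc_mono)
  interpret C: sym_digraph C
    using ind by (rule induced_graph_imp_graph)
  have sc: "strongly_connected C"
    using C.symmetric_connected_imp_strongly_connected[OF C.sym_arcs] max_subgraph_prop[OF C] by blast
  show "max_subgraph strongly_connected C"
  proof (rule max_subgraphI)
    show "strongly_connected C" by fact
    show "subgraph C G" using ind by blast
    fix y assume y: "C \<noteq> y" "subgraph C y" "subgraph y G"
    then interpret y: wf_digraph y by blast
    show "\<not> strongly_connected y"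
      using y C y.strongly_connected_imp_connected by (auto simp: max_subgraph_def)
  qed
next
  assume C: "max_subgraph strongly_connected C"
  then have ind: "induced_subgraph C G"
    using arc_mono_strongly_connected by (rule induced_subgraphI_arc_mono)
  interpret C: sym_digraph C
    using ind by (rule induced_graph_imp_graph)
  show "max_subgraph Digraph_Component.connected C"
  proof (rule max_subgraphI)
    show "Digraph_Component.connected C"
      using C.strongly_connected_imp_connected max_subgraph_prop[OF C] by blast
    show "subgraph C G" using ind by blast
    fix y assume y: "C \<noteq> y" "subgraph C y" "subgraph y G"
    let ?Y = "G \<restriction> verts y"
    have Yind: "induced_subgraph ?Y G"
      using y(3) by (intro induced_induce) blast
    interpret Y: sym_digraph ?Y
      using Yind by (rule induced_graph_imp_graph)
    have yY: "subgraph y ?Y"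
      using y(3) by (rule subgraph_induce_subgraphI2)
    have CY: "subgraph C ?Y"
      using y(2) yY by (rule subgraph_trans)
    show "\<not> Digraph_Component.connected y"
    proof
      assume "Digraph_Component.connected y"
      then have "Digraph_Component.connected ?Y"
        using arc_mono_connected yY unfolding arc_mono_def by (metis induce_subgraph_verts)
      then have "strongly_connected ?Y"
        using Y.symmetric_connected_imp_strongly_connected[OF Y.sym_arcs] by blast
      then have "?Y = C"
        using C CY Yind unfolding max_subgraph_def by blast
      then have "subgraph y C" using yY by simp
      then have "C = y"
        using y(2) by (auto simp: subgraph_def compatible_def intro!: pre_digraph.equality)
      then show False using y(1) by simp
    qed
  qed
qed

lemma (in sym_digraph) components_eq_sccs_verts: "components G = sccs_verts"
  unfolding components_def max_connected_iff_max_strongly_connected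
  by (simp add: sccs_verts_conv sccs_altdef2)

lemma sym_parcs: "pair_graph G \<Longrightarrow> sym (parcs G)"
  by (meson pair_graph.axioms(2) pair_pseudo_graph.axioms(2) pair_sym_digraph.arcs_symmetric symI)

lemma components_induce:
  assumes "pair_graph G" "X \<subseteq> pverts G"
  shows "components (with_proj G \<restriction> X) = component_at G X ` X"
proof -
  interpret pair_graph G by fact
  have "induced_subgraph (with_proj G \<restriction> X) (with_proj G)"
    using assms(2) by (intro induced_induce) simp
  then interpret X: sym_digraph "with_proj G \<restriction> X"
    by (rule induced_graph_imp_graph)
  have "X.scc_of x = component_at G X x" for x
    using X.symmetric_reachable'[unfolded reachable_induce_iff]
    by (auto simp: X.scc_of_def reachable_induce_iff)
  then show ?thesis
    by (simp add: X.components_eq_sccs_verts X.sccs_verts_conv_scc_of)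
qed

lemma symcl_sym: "sym r \<Longrightarrow> r\<^sup>s = r"
  by (auto simp: symcl_def dest: symD)

lemma connected_induce_iff:
  assumes "pair_graph G"
  shows "Digraph_Component.connected (with_proj G \<restriction> X) \<longleftrightarrow>
    X \<noteq> {} \<and> (\<forall>x \<in> X. component_at G X x = X)"
proof -
  have "sym (parcs G \<inter> X \<times> X)"
    using sym_parcs[OF assms] by (auto simp: sym_def)
  then have "Digraph_Component.connected (with_proj G \<restriction> X) \<longleftrightarrow>
      X \<noteq> {} \<and> (\<forall>x \<in> X. \<forall>y \<in> X. (x, y) \<in> rtrancl_on X (parcs G))"
    by (simp add: connected_conv arcs_ends_induce symcl_sym rtrancl_on_restrict)
  then show ?thesis
    using component_at_subset[of G X] by (auto simp: component_at_def)
qed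

lemma connected_iff:
  assumes "pair_graph G"
  shows "Digraph_Component.connected (with_proj G) \<longleftrightarrow>
    pverts G \<noteq> {} \<and> (\<forall>x \<in> pverts G. component_at G (pverts G) x = pverts G)"
proof -
  have "Digraph_Component.connected (with_proj G) \<longleftrightarrow>
      pverts G \<noteq> {} \<and> (\<forall>x \<in> pverts G. \<forall>y \<in> pverts G. (x, y) \<in> rtrancl_on (pverts G) (parcs G))"
    by (simp add: connected_conv symcl_sym[OF sym_parcs[OF assms]])
  then show ?thesis
    using component_at_subset[of G "pverts G"] by (auto simp: component_at_def)
qed

text \<open>
  Two components are compared exactly when some edge leaves the safe set between them, so the
  condition can be checked edge by edge; the correspondence between the components of two graphs
  then never has to be set up as a bijection.
\<close>

lemma weighted_safe_set_iff:
  assumes "pair_graph G"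
  shows "weighted_safe_set G w S \<longleftrightarrow>
    S \<noteq> {} \<and> S \<subseteq> pverts G \<and>
    (\<forall>(x, y) \<in> parcs G. x \<in> S \<longrightarrow> y \<notin> S \<longrightarrow>
      sum w (component_at G (pverts G - S) y) \<le> sum w (component_at G S x))"
proof (cases "S \<noteq> {} \<and> S \<subseteq> pverts G")
  case True
  interpret pair_graph G by fact
  note sym = sym_parcs[OF assms]
  have "(\<forall>C \<in> component_at G S ` S. \<forall>D \<in> component_at G (pverts G - S) ` (pverts G - S).
      edges_between G C D \<noteq> {} \<longrightarrow> sum w D \<le> sum w C) \<longleftrightarrow>
    (\<forall>(x, y) \<in> parcs G. x \<in> S \<longrightarrow> y \<notin> S \<longrightarrow>
      sum w (component_at G (pverts G - S) y) \<le> sum w (component_at G S x))" (is "?L \<longleftrightarrow> ?R")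
  proof
    assume L: ?L
    show ?R
    proof (clarify)
      fix x y assume xy: "(x, y) \<in> parcs G" "x \<in> S" "y \<notin> S"
      then have y: "y \<in> pverts G - S" using wellformed'(2) by blast
      have "(x, y) \<in> edges_between G (component_at G S x) (component_at G (pverts G - S) y)"
        using xy y by (auto simp: edges_between_def intro: component_at_self)
      then show "sum w (component_at G (pverts G - S) y) \<le> sum w (component_at G S x)"
        using L xy(2) y by blast
    qed
  next
    assume R: ?R
    show ?L
    proof (intro ballI impI)
      fix C D
      assume C: "C \<in> component_at G S ` S"
        and D: "D \<in> component_at G (pverts G - S) ` (pverts G - S)"
        and "edges_between G C D \<noteq> {}"
      then obtain x y where xy: "(x, y) \<in> parcs G" "x \<in> C" "y \<in> D"
        by (auto simp: edges_between_def)
      have "C = component_at G S x" "D = component_at G (pverts G - S) y"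
        using C D xy(2,3) by (auto dest: component_at_eq[OF sym])
      moreover have "x \<in> S" "y \<notin> S"
        using C D xy(2,3) by (auto dest: subsetD[OF component_at_subset])
      ultimately show "sum w D \<le> sum w C"
        using R xy(1) by blast
    qed
  qed
  then show ?thesis
    using True by (simp add: weighted_safe_set_def components_induce[OF assms])
next
  case False
  then show ?thesis by (auto simp: weighted_safe_set_def)
qed

lemma finite_safe_weights:
  assumes "pair_graph G"
  shows "finite {sum w S | S. weighted_safe_set G w S}"
    and "finite {sum w S | S. connected_weighted_safe_set G w S}"
proof -
  interpret pair_graph G by fact
  have fin: "finite (sum w ` Pow (pverts G))" using pair_finite_verts by simp
  show "finite {sum w S | S. weighted_safe_set G w S}"
    by (rule finite_subset[OF _ fin]) (auto simp: weighted_safe_set_def)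
  show "finite {sum w S | S. connected_weighted_safe_set G w S}"
    by (rule finite_subset[OF _ fin])
      (auto simp: weighted_safe_set_def connected_weighted_safe_set_def)
qed

lemma pverts_connected_weighted_safe_set:
  assumes "pair_graph G" "Digraph_Component.connected (with_proj G)"
  shows "connected_weighted_safe_set G w (pverts G)"
proof -
  interpret pair_graph G by fact
  show ?thesis
    using assms(2)
    by (auto dest: wellformed' simp: connected_weighted_safe_set_def weighted_safe_set_iff[OF assms(1)]
        connected_induce_iff[OF assms(1)] connected_iff[OF assms(1)])
qed

lemma safe_number_le:
  assumes "pair_graph G" "weighted_safe_set G w S"
  shows "safe_number G w \<le> sum w S"
  unfolding safe_number_def using assms finite_safe_weights by (intro Min_le) auto

lemma connected_safe_number_le:
  assumes "pair_graph G" "connected_weighted_safe_set G w S"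
  shows "connected_safe_number G w \<le> sum w S"
  unfolding connected_safe_number_def using assms finite_safe_weights by (intro Min_le) auto

lemma safe_number_attained:
  assumes "pair_graph G" "Digraph_Component.connected (with_proj G)"
  obtains S where "weighted_safe_set G w S" "safe_number G w = sum w S"
proof -
  have "safe_number G w \<in> {sum w S | S. weighted_safe_set G w S}"
    unfolding safe_number_def
    using finite_safe_weights(1)[OF assms(1)] pverts_connected_weighted_safe_set[OF assms, of w]
    by (intro Min_in) (auto simp: connected_weighted_safe_set_def)
  then show thesis using that by blast
qed

lemma connected_safe_number_attained:
  assumes "pair_graph G" "Digraph_Component.connected (with_proj G)"
  obtains S where "connected_weighted_safe_set G w S" "connected_safe_number G w = sum w S"
proof -
  have "connected_safe_number G w \<in> {sum w S | S. connected_weighted_safe_set G w S}"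
    unfolding connected_safe_number_def
    using finite_safe_weights(2)[OF assms(1)] pverts_connected_weighted_safe_set[OF assms, of w]
    by (intro Min_in) auto
  then show thesis using that by blast
qed

section \<open>Paths before and after suppression\<close>

locale degree_two_vertex = pair_graph H for H :: "'a pair_pre_digraph" +
  fixes v a b :: 'a
  assumes neighbours_distinct: "a \<noteq> b"
    and neighbours: "\<And>x. (v, x) \<in> parcs H \<longleftrightarrow> x = a \<or> x = b"
begin

abbreviation "G \<equiv> suppress H v"

lemma neighbours': "(x, v) \<in> parcs H \<longleftrightarrow> x = a \<or> x = b"
  using neighbours arcs_symmetric by blast

lemma neighbours_neq: "a \<noteq> v" "b \<noteq> v"
  using neighbours no_loops' by blast+

lemma in_verts: "v \<in> pverts H" "a \<in> pverts H" "b \<in> pverts H"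
  using neighbours wellformed' by blast+

lemma pverts_suppress: "pverts G = pverts H - {v}"
  by (simp add: suppress_def)

lemma arc_suppress_iff:
  "(x, y) \<in> parcs G \<longleftrightarrow>
    (x, y) \<in> parcs H \<and> x \<noteq> v \<and> y \<noteq> v \<or> x = a \<and> y = b \<or> x = b \<and> y = a"
  using neighbours_distinct by (auto simp: suppress_def neighbours)

lemma pair_graph_suppress: "pair_graph G"
proof -
  have fin: "finite (pverts G)"
    using pair_finite_verts by (simp add: pverts_suppress)
  have subset: "parcs G \<subseteq> pverts G \<times> pverts G"
    using in_verts neighbours_neq
    by (auto simp: arc_suppress_iff pverts_suppress dest: wellformed')
  then have verts: "fst e \<in> pverts G" "snd e \<in> pverts G" if "e \<in> parcs G" for e
    using that by auto
  from subset have "finite (parcs G)"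
    by (rule finite_subset) (use fin in simp)
  moreover have "sym (parcs G)"
    by (auto simp: sym_def arc_suppress_iff intro: arcs_symmetric)
  moreover have "fst e \<noteq> snd e" if "e \<in> parcs G" for e
    using that neighbours_distinct by (cases e) (auto simp: arc_suppress_iff dest: no_loops')
  ultimately show ?thesis
    using fin verts by unfold_locales (simp_all add: symmetric_def)
qed

text \<open>
  A path of \<open>H\<close> that passes through \<open>v\<close> enters and leaves it at \<open>a\<close> or \<open>b\<close>, and the edge \<open>ab\<close> of
  \<open>G\<close> is the shortcut. For the induction, a path that stops at \<open>v\<close> is cut back to the
  neighbour from which it entered.
\<close>

lemma project_path:
  assumes "(x, y) \<in> rtrancl_on Y (parcs H)" "x \<noteq> v"
  shows "if y = v then \<exists>c. (c = a \<or> c = b) \<and> (x, c) \<in> rtrancl_on (Y - {v}) (parcs G)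
    else (x, y) \<in> rtrancl_on (Y - {v}) (parcs G)"
  using assms(1)
proof (induction rule: rtrancl_on_induct)
  case base
  then show ?case using assms(2) by auto
next
  case (step y z)
  show ?case
  proof (cases "y = v")
    case True
    then obtain c where c: "c = a \<or> c = b" "(x, c) \<in> rtrancl_on (Y - {v}) (parcs G)"
      using step.IH by auto
    have z: "z = a \<or> z = b" "z \<noteq> v"
      using step.hyps(2) True neighbours neighbours_neq by auto
    have "(x, z) \<in> rtrancl_on (Y - {v}) (parcs G)"
    proof (cases "z = c")
      case False
      then have "(c, z) \<in> parcs G" using c(1) z(1) by (auto simp: arc_suppress_iff)
      then show ?thesis using c(2) z(2) step.hyps(4) by (auto intro: rtrancl_on_into_rtrancl_on)
    qed (use c(2) in simp)
    then show ?thesis using z(2) by simp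
  next
    case False
    then have y: "(x, y) \<in> rtrancl_on (Y - {v}) (parcs G)"
      using step.IH by simp
    show ?thesis
    proof (cases "z = v")
      case True
      then show ?thesis using y step.hyps(2) neighbours' by auto
    next
      case z: False
      then have "(y, z) \<in> parcs G" using False step.hyps(2) by (simp add: arc_suppress_iff)
      then show ?thesis using y z step.hyps(4) by (auto intro: rtrancl_on_into_rtrancl_on)
    qed
  qed
qed

lemma component_at_project:
  assumes "x \<noteq> v"
  shows "component_at H Y x - {v} \<subseteq> component_at G (Y - {v}) x"
  using project_path[OF _ assms, of _ Y] by (auto simp: component_at_def split: if_splits)

text \<open>
  The only edge that may be new in \<open>G\<close> is \<open>ab\<close>; a path using it can take the detour through \<open>v\<close> as
  long as \<open>v\<close> belongs to the larger set.
\<close>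

lemma component_at_lift:
  assumes "X \<subseteq> Y" "a \<in> X \<Longrightarrow> b \<in> X \<Longrightarrow> v \<in> Y"
  shows "component_at G X x \<subseteq> component_at H Y x"
proof
  fix y assume "y \<in> component_at G X x"
  then have "(x, y) \<in> rtrancl_on X (parcs G)" by (simp add: component_at_def)
  then have "(x, y) \<in> rtrancl_on Y (parcs H)"
  proof (induction rule: rtrancl_on_induct)
    case base
    then show ?case using assms(1) by auto
  next
    case (step y z)
    show ?case
    proof (cases "(y, z) \<in> parcs H")
      case True
      then show ?thesis using step assms(1) by (auto intro: rtrancl_on_into_rtrancl_on)
    next
      case False
      then have ab: "y = a \<and> z = b \<or> y = b \<and> z = a"
        using step.hyps(2) by (auto simp: arc_suppress_iff)
      then have "v \<in> Y" "(y, v) \<in> parcs H" "(v, z) \<in> parcs H"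
        using step.hyps(3,4) assms(2) neighbours neighbours' by auto
      then show ?thesis
        using step.IH step.hyps(4) assms(1) by (meson rtrancl_on_into_rtrancl_on subsetD)
    qed
  qed
  then show "y \<in> component_at H Y x" by (simp add: component_at_def)
qed

lemma component_at_step:
  assumes "(x, y) \<in> parcs H" "x \<in> X" "y \<in> X"
  shows "component_at H X y = component_at H X x"
  using assms
  by (intro component_at_eq sym_parcs pair_graph)
    (auto simp: component_at_def intro: rtrancl_on_into_rtrancl_on)

lemma connected_induce_project:
  assumes "\<And>x. x \<in> Y \<Longrightarrow> component_at H Y x = Y" "x \<in> Y - {v}"
  shows "component_at G (Y - {v}) x = Y - {v}"
  using component_at_project[of x Y] component_at_subset[of G "Y - {v}" x] assms by blast

lemma connected_suppress:
  assumes "Digraph_Component.connected (with_proj H)"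
  shows "Digraph_Component.connected (with_proj G)"
  using assms connected_induce_project[of "pverts H"] in_verts neighbours_neq
  by (auto simp: connected_iff[OF pair_graph] connected_iff[OF pair_graph_suppress] pverts_suppress)

section \<open>Transporting safe sets\<close>

text \<open>
  The value of \<open>w\<close> at \<open>v\<close>, which is not a vertex of \<open>G\<close>, is arbitrary and must be replaced by \<open>0\<close>
  before \<open>\<delta>\<close> is added.
\<close>

definition perturbed :: "real \<Rightarrow> 'a set \<Rightarrow> ('a \<Rightarrow> real) \<Rightarrow> 'a \<Rightarrow> real" where
  "perturbed \<delta> S w x = (if x = v then 0 else w x) + (if x \<in> insert v S then \<delta> else 0)"

lemma sum_perturbed:
  assumes "finite A"
  shows "sum (perturbed \<delta> S w) A = sum w (A - {v}) + of_nat (card (A \<inter> insert v S)) * \<delta>"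
proof -
  have "(\<Sum>x\<in>A. if x = v then 0 else w x) = sum w (A - {v})"
    using assms by (intro sum.mono_neutral_cong_right) auto
  moreover have "(\<Sum>x\<in>A. if x \<in> insert v S then \<delta> else 0) = of_nat (card (A \<inter> insert v S)) * \<delta>"
    using assms by (subst sum.inter_restrict[symmetric]) auto
  ultimately show ?thesis
    by (simp add: perturbed_def sum.distrib)
qed

lemma sum_weight_mono:
  assumes w: "w \<in> weight_functions G" and sub: "A \<subseteq> B" "B \<subseteq> pverts H - {v}"
  shows "sum w A \<le> sum w B"
proof (rule sum_mono2)
  show "finite B" using finite_subset[OF sub(2)] pair_finite_verts by simp
  show "0 \<le> w x" if "x \<in> B - A" for x
    using w that sub(2) by (auto simp: weight_functions_def pverts_suppress intro: less_imp_le)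
qed fact

text \<open>
  Adding \<open>v\<close> to \<open>S\<close> when it has a neighbour there can only enlarge components of \<open>S\<close>. Otherwise \<open>v\<close>
  stays outside, where it raises the weight of a single component by \<open>\<delta>\<close>; every component of \<open>S\<close>
  has gained at least as much.
\<close>

lemma lift_safe:
  assumes safe: "weighted_safe_set G w S"
    and w: "w \<in> weight_functions G" and "0 \<le> \<delta>"
  shows "\<exists>S'. weighted_safe_set H (perturbed \<delta> S w) S' \<and> S' - {v} = S"
proof -
  let ?w = "perturbed \<delta> S w"
  let ?V = "pverts H"
  have S: "S \<noteq> {}" "S \<subseteq> ?V" "v \<notin> S"
    and le: "\<And>x y. (x, y) \<in> parcs G \<Longrightarrow> x \<in> S \<Longrightarrow> y \<notin> S \<Longrightarrow>
      sum w (component_at G (?V - {v} - S) y) \<le> sum w (component_at G S x)"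
    using safe unfolding weighted_safe_set_iff[OF pair_graph_suppress] pverts_suppress by blast+
  have fin: "finite A" if "A \<subseteq> ?V" for A
    using that pair_finite_verts by (rule finite_subset)
  have finc: "finite (component_at K X x)" if "X \<subseteq> ?V" for K X x
    using that by (intro fin order_trans[OF component_at_subset])
  have mono: "sum w A \<le> sum w B" if "A \<subseteq> B" "B \<subseteq> ?V - {v}" for A B
    using sum_weight_mono[OF w that] .
  show ?thesis
  proof (cases "a \<in> S \<or> b \<in> S")
    case True
    let ?S = "insert v S"
    have "sum ?w (component_at H (?V - ?S) y) \<le> sum ?w (component_at H ?S x)"
      if xy: "(x, y) \<in> parcs H" "x \<in> ?S" "y \<notin> ?S" for x y
    proof -
      \<comment> \<open>An edge from \<open>v\<close> to \<open>b\<close>, say, leaving the set is matched by the edge \<open>ab\<close> of \<open>G\<close>.\<close>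
      obtain x' where x': "x' \<in> S" "(x', y) \<in> parcs G" "component_at H ?S x' = component_at H ?S x"
      proof (cases "x = v")
        case False
        then show thesis using xy that[of x] by (auto simp: arc_suppress_iff)
      next
        case x: True
        then have y: "y = a \<or> y = b" using xy neighbours by simp
        define c where "c = (if y = a then b else a)"
        have "c \<in> S" "(c, y) \<in> parcs G" "(v, c) \<in> parcs H"
          using y True xy(3) neighbours neighbours_distinct
          by (auto simp: c_def arc_suppress_iff)
        then show thesis using that[of c] x component_at_step[of v c ?S] by simp
      qed
      have D: "component_at H (?V - ?S) y \<subseteq> component_at G (?V - {v} - S) y"
      proof -
        have "?V - ?S - {v} = ?V - {v} - S" "component_at H (?V - ?S) y - {v} = component_at H (?V - ?S) y"
          using component_at_subset[of H "?V - ?S" y] by auto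
        then show ?thesis using component_at_project[of y "?V - ?S"] xy(3) by auto
      qed
      have "sum ?w (component_at H (?V - ?S) y) = sum w (component_at H (?V - ?S) y)"
        using component_at_subset[of H "?V - ?S" y] by (intro sum.cong) (auto simp: perturbed_def)
      also have "\<dots> \<le> sum w (component_at G (?V - {v} - S) y)"
        using D component_at_subset[of G "?V - {v} - S" y] by (intro mono) auto
      also have "\<dots> \<le> sum w (component_at G S x')"
        using le x' xy(3) by blast
      also have "\<dots> \<le> sum w (component_at H ?S x - {v})"
        using component_at_lift[of S ?S x'] component_at_subset[of G S x'] x'(3) S
          component_at_subset[of H ?S x] in_verts
        by (intro mono) auto
      also have "\<dots> \<le> sum ?w (component_at H ?S x)"
        using finc[of ?S] S(2) in_verts \<open>0 \<le> \<delta>\<close> by (subst sum_perturbed) auto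
      finally show ?thesis .
    qed
    then have "weighted_safe_set H ?w ?S"
      using S in_verts unfolding weighted_safe_set_iff[OF pair_graph] by blast
    then show ?thesis using S(3) by (intro exI[of _ ?S]) auto
  next
    case False
    have "sum ?w (component_at H (?V - S) y) \<le> sum ?w (component_at H S x)"
      if xy: "(x, y) \<in> parcs H" "x \<in> S" "y \<notin> S" for x y
    proof -
      have "y \<noteq> v" using xy False neighbours' by auto
      then have xyG: "(x, y) \<in> parcs G" using xy S(3) by (auto simp: arc_suppress_iff)
      \<comment> \<open>The component outside \<open>S\<close> contains at most one vertex, \<open>v\<close>, of increased weight,
        the component inside \<open>S\<close> at least one, \<open>x\<close>.\<close>
      have "component_at H (?V - S) y \<inter> insert v S \<subseteq> {v}"
        using component_at_subset[of H "?V - S" y] by auto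
      then have card_out: "card (component_at H (?V - S) y \<inter> insert v S) \<le> 1"
        using card_mono[of "{v}"] by fastforce
      have "x \<in> component_at H S x \<inter> insert v S"
        using xy by (auto intro: component_at_self)
      then have card_in: "1 \<le> card (component_at H S x \<inter> insert v S)"
        using finc[of S H x] S(2) by (metis One_nat_def Suc_leI card_gt_0_iff empty_iff finite_Int)
      have "?V - S - {v} = ?V - {v} - S" by auto
      then have "component_at H (?V - S) y - {v} \<subseteq> component_at G (?V - {v} - S) y"
        using component_at_project[OF \<open>y \<noteq> v\<close>, of "?V - S"] by simp
      then have "sum w (component_at H (?V - S) y - {v}) \<le> sum w (component_at G (?V - {v} - S) y)"
        using component_at_subset[of G "?V - {v} - S" y] by (intro mono) auto
      also have "\<dots> \<le> sum w (component_at G S x)"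
        using le xyG xy by blast
      also have "\<dots> \<le> sum w (component_at H S x - {v})"
        using component_at_lift[of S S x] component_at_subset[of G S x] False S
          component_at_subset[of H S x]
        by (intro mono) auto
      finally have "sum w (component_at H (?V - S) y - {v}) \<le> sum w (component_at H S x - {v})" .
      moreover have "of_nat (card (component_at H (?V - S) y \<inter> insert v S)) * \<delta>
          \<le> of_nat (card (component_at H S x \<inter> insert v S)) * \<delta>"
        using card_out card_in \<open>0 \<le> \<delta>\<close> by (intro mult_right_mono) auto
      ultimately show ?thesis
        using finc[of S] finc[of "?V - S"] S(2) by (simp add: sum_perturbed)
    qed
    then have "weighted_safe_set H ?w S"
      using S unfolding weighted_safe_set_iff[OF pair_graph] by blast
    then show ?thesis using S(3) by (intro exI[of _ S]) auto
  qed
qed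

text \<open>
  The hypotheses say that \<open>w'\<close> differs from \<open>w\<close> by less than any nonzero difference between the
  \<open>w\<close>-weights of two vertex sets. The comparison required for the edge \<open>ab\<close> of \<open>G\<close>, when it joins the set to its
  complement, comes from the edge of \<open>H\<close> at \<open>v\<close> that does so.
\<close>

lemma project_connected_safe:
  assumes conn_safe: "connected_weighted_safe_set H w' T'"
    and w: "w \<in> weight_functions G"
    and lower: "\<And>A. A \<subseteq> pverts H \<Longrightarrow> sum w (A - {v}) \<le> sum w' A"
    and upper: "\<And>A. A \<subseteq> pverts H \<Longrightarrow> sum w' A \<le> sum w (A - {v}) + \<epsilon>"
    and separated: "\<And>A B. A \<subseteq> pverts G \<Longrightarrow> B \<subseteq> pverts G \<Longrightarrow>
      sum w A < sum w B \<Longrightarrow> sum w A + \<epsilon> < sum w B"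
  shows "connected_weighted_safe_set G w (T' - {v})"
proof -
  let ?V = "pverts H"
  let ?T = "T' - {v}"
  have T': "T' \<noteq> {}" "T' \<subseteq> ?V"
    and le: "\<And>x y. (x, y) \<in> parcs H \<Longrightarrow> x \<in> T' \<Longrightarrow> y \<notin> T' \<Longrightarrow>
      sum w' (component_at H (?V - T') y) \<le> sum w' (component_at H T' x)"
    and conn: "\<And>x. x \<in> T' \<Longrightarrow> component_at H T' x = T'"
    using conn_safe
    unfolding connected_weighted_safe_set_def weighted_safe_set_iff[OF pair_graph]
      connected_induce_iff[OF pair_graph] by blast+
  \<comment> \<open>Passing from \<open>w'\<close> to \<open>w\<close> costs at most \<open>\<epsilon>\<close>, too little to reverse an inequality.\<close>
  have transfer: "sum w (D - {v}) \<le> sum w ?T" if "D \<subseteq> ?V" "sum w' D \<le> sum w' T'" for D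
  proof (rule ccontr)
    assume "\<not> ?thesis"
    then have "sum w ?T + \<epsilon> < sum w (D - {v})"
      using that(1) T'(2) by (intro separated) (auto simp: pverts_suppress)
    then show False
      using that(2) lower[OF that(1)] upper[OF T'(2)] by linarith
  qed
  have mono: "sum w A \<le> sum w B" if "A \<subseteq> B" "B \<subseteq> ?V - {v}" for A B
    using sum_weight_mono[OF w that] .
  have T: "?T \<noteq> {}"
  proof
    \<comment> \<open>The set \<open>{v}\<close> is too light to dominate the component of \<open>a\<close>.\<close>
    assume empty: "?T = {}"
    then have Tv: "T' = {v}" using T'(1) by auto
    let ?D = "component_at H (?V - T') a"
    have "sum w' ?D \<le> sum w' T'"
      using le[of v a] conn[of v] Tv neighbours neighbours_neq by auto
    then have "sum w (?D - {v}) \<le> 0"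
      using transfer[of ?D] component_at_subset[of H "?V - T'" a] empty by (simp add: subset_iff)
    moreover have "{a} \<subseteq> ?D - {v}"
      using Tv in_verts neighbours_neq by (auto intro: component_at_self)
    then have "sum w {a} \<le> sum w (?D - {v})"
      using component_at_subset[of H "?V - T'" a] by (intro mono) auto
    moreover have "0 < sum w {a}"
      using w in_verts neighbours_neq by (simp add: weight_functions_def pverts_suppress)
    ultimately show False by linarith
  qed
  have connT: "component_at G ?T x = ?T" if "x \<in> ?T" for x
    using connected_induce_project[OF conn that] .
  have "sum w (component_at G (?V - {v} - ?T) y) \<le> sum w (component_at G ?T x)"
    if xy: "(x, y) \<in> parcs G" "x \<in> ?T" "y \<notin> ?T" for x y
  proof -
    have y: "y \<noteq> v" "y \<in> ?V" "y \<notin> T'"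
      using xy in_verts neighbours_neq by (auto simp: arc_suppress_iff dest: wellformed')
    let ?D = "component_at H (?V - T') y"
    \<comment> \<open>If \<open>v\<close> is in \<open>T'\<close>, then so is one of its neighbours, because \<open>T'\<close> is connected and
      contains \<open>x\<close>; hence the new edge does not join two vertices outside.\<close>
    have "a \<in> T' \<or> b \<in> T'" if "v \<in> T'"
    proof -
      have "(x, v) \<in> rtrancl_on T' (parcs H)"
        using conn[of x] xy(2) that by (auto simp: component_at_def)
      then show ?thesis
        using project_path[of x v T'] xy(2) by (auto dest: in_rtrancl_on_in_F)
    qed
    then have "component_at G (?V - {v} - ?T) y \<subseteq> ?D"
      using in_verts by (intro component_at_lift) auto
    then have sub: "component_at G (?V - {v} - ?T) y \<subseteq> ?D - {v}"
      using component_at_subset[of G "?V - {v} - ?T" y] by auto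
    have D: "sum w' ?D \<le> sum w' T'"
    proof (cases "(x, y) \<in> parcs H")
      case True
      then show ?thesis using le[of x y] conn[of x] xy(2) y(3) by auto
    next
      case False
      then have ab: "(x, v) \<in> parcs H" "(v, y) \<in> parcs H"
        using xy(1) neighbours neighbours' by (auto simp: arc_suppress_iff)
      show ?thesis
      proof (cases "v \<in> T'")
        case True
        then show ?thesis using le[of v y] conn[of v] ab(2) y(3) by simp
      next
        case False
        then have "component_at H (?V - T') v = ?D"
          using component_at_step[OF ab(2), of "?V - T'"] y in_verts by simp
        then show ?thesis using le[of x v] conn[of x] ab(1) xy(2) False by simp
      qed
    qed
    have "sum w (component_at G (?V - {v} - ?T) y) \<le> sum w (?D - {v})"
      using sub component_at_subset[of H "?V - T'" y] by (intro mono) auto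
    also have "\<dots> \<le> sum w ?T"
      using D component_at_subset[of H "?V - T'" y] by (intro transfer) auto
    finally show ?thesis using connT[OF xy(2)] by simp
  qed
  then show ?thesis
    using T T'(2) connT
    unfolding connected_weighted_safe_set_def weighted_safe_set_iff[OF pair_graph_suppress]
      connected_induce_iff[OF pair_graph_suppress] pverts_suppress by blast
qed

end

section \<open>Closure under suppression\<close>

lemma subset_sums_separated:
  fixes w :: "'a \<Rightarrow> real"
  assumes "finite V"
  obtains \<epsilon> where "0 < \<epsilon>"
    "\<And>A B. A \<subseteq> V \<Longrightarrow> B \<subseteq> V \<Longrightarrow> sum w A < sum w B \<Longrightarrow> sum w A + \<epsilon> < sum w B"
proof -
  let ?gaps = "{d \<in> (\<lambda>(A, B). sum w B - sum w A) ` (Pow V \<times> Pow V). 0 < d}"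
  \<comment> \<open>The number \<open>1\<close> only keeps the set non-empty when no two sums differ.\<close>
  define m where "m = Min (insert 1 ?gaps)"
  have fin: "finite (insert 1 ?gaps)" using assms by simp
  have "0 < m" unfolding m_def using fin by (subst Min_gr_iff) auto
  show thesis
  proof (rule that[of "m / 2"])
    show "0 < m / 2" using \<open>0 < m\<close> by simp
    fix A B assume "A \<subseteq> V" "B \<subseteq> V" "sum w A < sum w B"
    then have "sum w B - sum w A \<in> insert 1 ?gaps" by force
    then have "m \<le> sum w B - sum w A" unfolding m_def using fin by (rule Min_le[rotated])
    then show "sum w A + m / 2 < sum w B" using \<open>0 < m\<close> by linarith
  qed
qed

lemma (in degree_two_vertex) safe_numbers_eq:
  assumes H: "H \<in> Gcs" and w: "w \<in> weight_functions G"
  shows "safe_number G w = connected_safe_number G w"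
proof (rule ccontr)
  have connH: "Digraph_Component.connected (with_proj H)"
    and eqH: "\<And>w'. w' \<in> weight_functions H \<Longrightarrow> safe_number H w' = connected_safe_number H w'"
    using H by (auto simp: Gcs_def)
  note connG = connected_suppress[OF connH]
  obtain S where S: "weighted_safe_set G w S" "safe_number G w = sum w S"
    using safe_number_attained[OF pair_graph_suppress connG] .
  obtain T where T: "connected_weighted_safe_set G w T" "connected_safe_number G w = sum w T"
    using connected_safe_number_attained[OF pair_graph_suppress connG] .
  assume "safe_number G w \<noteq> connected_safe_number G w"
  moreover have "safe_number G w \<le> sum w T"
    using T(1) by (intro safe_number_le pair_graph_suppress) (simp add: connected_weighted_safe_set_def)
  ultimately have less: "sum w S < sum w T" using S(2) T(2) by simp
  have "finite (pverts G)" using pair_finite_verts by (simp add: pverts_suppress)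
  then obtain \<epsilon> where \<epsilon>: "0 < \<epsilon>" and
    separated: "\<And>A B. A \<subseteq> pverts G \<Longrightarrow> B \<subseteq> pverts G \<Longrightarrow> sum w A < sum w B \<Longrightarrow>
      sum w A + \<epsilon> < sum w B"
    using subset_sums_separated[of "pverts G" w] by blast
  \<comment> \<open>Chosen so that the total increase over any set of vertices is at most \<open>\<epsilon>\<close>.\<close>
  define \<delta> where "\<delta> = \<epsilon> / of_nat (card (pverts H))"
  have card: "0 < card (pverts H)"
    using in_verts pair_finite_verts by (auto simp: card_gt_0_iff)
  then have \<delta>: "0 < \<delta>" using \<epsilon> by (simp add: \<delta>_def)
  let ?w = "perturbed \<delta> S w"
  have lower: "sum w (A - {v}) \<le> sum ?w A" if "A \<subseteq> pverts H" for A
    using finite_subset[OF that pair_finite_verts] \<delta> by (simp add: sum_perturbed)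
  have upper: "sum ?w A \<le> sum w (A - {v}) + \<epsilon>" if "A \<subseteq> pverts H" for A
  proof -
    have "card (A \<inter> insert v S) \<le> card (pverts H)"
      using that pair_finite_verts by (intro card_mono) auto
    then have "of_nat (card (A \<inter> insert v S)) * \<delta> \<le> of_nat (card (pverts H)) * \<delta>"
      using \<delta> by (intro mult_right_mono) auto
    also have "\<dots> = \<epsilon>"
      using in_verts pair_finite_verts by (auto simp: \<delta>_def)
    finally show ?thesis
      using finite_subset[OF that pair_finite_verts] by (simp add: sum_perturbed)
  qed
  have w': "?w \<in> weight_functions H"
    using w \<delta> by (auto simp: weight_functions_def perturbed_def pverts_suppress add_pos_pos)
  obtain S' where S': "weighted_safe_set H ?w S'" "S' - {v} = S"
    using lift_safe[OF S(1) w less_imp_le[OF \<delta>]] by blast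
  obtain T' where T': "connected_weighted_safe_set H ?w T'"
    "connected_safe_number H ?w = sum ?w T'"
    using connected_safe_number_attained[OF pair_graph connH] .
  have "safe_number H ?w \<le> sum ?w S'"
    using S'(1) by (intro safe_number_le pair_graph)
  also have "\<dots> \<le> sum w S + \<epsilon>"
    using upper[of S'] S' by (simp add: weighted_safe_set_def)
  also have "\<dots> < sum w T"
    using less S(1) T(1) by (intro separated)
      (auto simp: weighted_safe_set_def connected_weighted_safe_set_def)
  also have "\<dots> \<le> sum w (T' - {v})"
    using connected_safe_number_le[OF pair_graph_suppress
        project_connected_safe[OF T'(1) w lower upper separated]] T(2) by simp
  also have "\<dots> \<le> sum ?w T'"
    using T'(1) by (intro lower)
      (simp add: weighted_safe_set_def connected_weighted_safe_set_def)
  finally show False using eqH[OF w'] T'(2) by simp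
qed

theorem theorem1p6:
  fixes Gstar G :: "'a pair_pre_digraph" and v :: 'a
  assumes "Gstar \<in> Gcs"
    and "v \<in> pverts Gstar"
    and "out_degree (with_proj Gstar) v = 2"
    and "\<not> on_triangle Gstar v"
    and "G = suppress Gstar v"
  shows "G \<in> Gcs"
proof -
  interpret pair_graph Gstar using assms(1) by (simp add: Gcs_def)
  have "out_arcs (with_proj Gstar) v = Pair v ` {x. (v, x) \<in> parcs Gstar}"
    by (auto simp: out_arcs_def)
  then have "card {x. (v, x) \<in> parcs Gstar} = 2"
    using assms(3) by (simp add: out_degree_def card_image inj_on_def)
  then obtain a b where "{x. (v, x) \<in> parcs Gstar} = {a, b}" "a \<noteq> b"
    by (auto simp: card_2_iff)
  then interpret degree_two_vertex Gstar v a b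
    by unfold_locales auto
  show ?thesis
    using pair_graph_suppress connected_suppress safe_numbers_eq[OF assms(1)] assms(1)
    unfolding assms(5) by (simp add: Gcs_def)
qed

end
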